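(* Fix a connected graph $H$ on $\zeta\ge 2$ vertices, $\theta>0$ and $\beta_0\in\mathbb{R}$. Consider testing $\mathcal{H}_0:\bm\beta=\beta_0\mathbf 1$ against $\mathcal{H}_1:\bm\beta\in\Xi(s,A)$ from one observation $G\sim\mathbb{P}_{n,\theta,\bm\beta}$ of the degree corrected ERGM with subgraph $H$. There exist positive constants $\kappa,C$ (not depending on $n$) such that, for any sequences $s=s_n\in\{1,\dots,n\}$ and $A=A_n\ge\kappa\sqrt{\frac{\log n}{n}}$, with $L_n=C\sqrt{n\log n}$ the test $$T_n(G)=\mathbf 1\Big\{\max_{i\in[n]}\sum_{e\ni i}\Big[G_e-\mathbb{E}_{n,\theta,\beta_0\mathbf 1}\big(G_e\,\big|\,G_f:f\in\mathcal{E},f\neq e\big)\Big]>L_n\Big\}$$ is asymptotically powerful, i.e. $$\lim_{n\to\infty}\Big[\mathbb{P}_{n,\theta,\beta_0\mathbf 1}(T_n(G)=1)+\sup_{\bm\beta\in\Xi(s_n,A_n)}\mathbb{P}_{n,\theta,\bm\beta}(T_n(G)=0)\Big]=0.$$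
   Context: $\mathcal{G}_n$ is the set of simple labeled graphs on $[n]=\{1,\dots,n\}$; a graph $G$ is identified with its $\{0,1\}$ symmetric adjacency matrix, $G_{ii}=0$. $\mathcal{E}=\{(i,j):1\le i<j\le n\}$, for $e=(i,j)\in\mathcal{E}$, $G_e=G_{ij}$, and $e\ni i$ means $e\in\mathcal{E}$ has $i$ as an endpoint. Degrees: $d_i=\sum_{j}G_{ij}$. For a fixed connected graph $H$ with vertex set $[\zeta]$, $N(H,G)=\sum_{\iota}\prod_{(i,j)\in E(H)}G_{\iota(i),\iota(j)}$, where the sum is over all injective maps $\iota:[\zeta]\to[n]$ and $E(H)$ is the edge set of $H$ (each edge taken once). The degree corrected ERGM is the probability mass function on $\mathcal{G}_n$ $$\mathbb{P}_{n,\theta,\bm\beta}(G)=\frac{1}{Z_n(\bm\beta,\theta,H)}\exp\Big\{\frac{\theta}{n^{\zeta-2}}N(H,G)+\sum_{i=1}^n\beta_id_i\Big\},\quad \bm\beta\in\mathbb{R}^n,$$ with $Z_n$ the normalizing constant and $\mathbb{E}_{n,\theta,\bm\beta}$ the expectation. $\mathbf 1$ is the all-ones vector. The parameters $\theta,\beta_0$ are known. The alternative is $$\Xi(s,A)=\{\bm\beta=\beta_0\mathbf 1+\bm\mu:\ |\mathrm{supp}(\bm\mu)|\ge s,\ \min_{i\in\mathrm{supp}(\bm\mu)}\mu_i\ge A\}.$$ *)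

theory Defs
  imports "HOL-Probability.Probability"
begin

text \<open>
  A simple labelled graph on \<open>{1..n}\<close> is encoded by its set of edges, the edge between
  \<open>i < j\<close> being the ordered pair \<open>(i, j)\<close>; so every edge occurs exactly once.
\<close>

type_synonym graph = "(nat \<times> nat) set"

definition pairs :: "nat \<Rightarrow> (nat \<times> nat) set" where
  "pairs n = {(i, j). 1 \<le> i \<and> i < j \<and> j \<le> n}"

definition graphs :: "nat \<Rightarrow> graph set" where
  "graphs n = Pow (pairs n)"

definition adj :: "graph \<Rightarrow> nat \<Rightarrow> nat \<Rightarrow> real" where
  "adj G i j = of_bool ((i, j) \<in> G \<or> (j, i) \<in> G)"

definition edge_var :: "graph \<Rightarrow> nat \<times> nat \<Rightarrow> real" where
  "edge_var G e = adj G (fst e) (snd e)"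

definition deg :: "nat \<Rightarrow> graph \<Rightarrow> nat \<Rightarrow> real" where
  "deg n G i = (\<Sum>j\<in>{1..n}. adj G i j)"

definition incident_pairs :: "nat \<Rightarrow> nat \<Rightarrow> (nat \<times> nat) set" where
  "incident_pairs n i = {e \<in> pairs n. i = fst e \<or> i = snd e}"

definition connected_graph :: "nat \<Rightarrow> graph \<Rightarrow> bool" where
  "connected_graph k H \<longleftrightarrow> H \<in> graphs k \<and>
     (\<forall>u\<in>{1..k}. \<forall>v\<in>{1..k}. (u, v) \<in> {(i, j). adj H i j = 1}\<^sup>*)"

definition subgraph_count :: "nat \<Rightarrow> graph \<Rightarrow> nat \<Rightarrow> graph \<Rightarrow> real" where
  "subgraph_count k H n G =
     (\<Sum>\<iota> \<in> {\<iota> \<in> {1..k} \<rightarrow>\<^sub>E {1..n}. inj_on \<iota> {1..k}}.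
        \<Prod>(i, j)\<in>H. adj G (\<iota> i) (\<iota> j))"

text \<open>
  Vectors in \<open>\<real>\<^sup>n\<close> are functions \<open>nat \<Rightarrow> real\<close>
  of which only the values on \<open>{1..n}\<close> are used.
\<close>

definition ergm_weight ::
    "nat \<Rightarrow> graph \<Rightarrow> nat \<Rightarrow> real \<Rightarrow> (nat \<Rightarrow> real) \<Rightarrow> graph \<Rightarrow> real" where
  "ergm_weight k H n \<theta> \<beta> G =
     exp (\<theta> / real n ^ (k - 2) * subgraph_count k H n G + (\<Sum>i\<in>{1..n}. \<beta> i * deg n G i))"

definition ergm_Z ::
    "nat \<Rightarrow> graph \<Rightarrow> nat \<Rightarrow> real \<Rightarrow> (nat \<Rightarrow> real) \<Rightarrow> real" where
  "ergm_Z k H n \<theta> \<beta> = (\<Sum>G\<in>graphs n. ergm_weight k H n \<theta> \<beta> G)"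

definition ergm ::
    "nat \<Rightarrow> graph \<Rightarrow> nat \<Rightarrow> real \<Rightarrow> (nat \<Rightarrow> real) \<Rightarrow> graph pmf" where
  "ergm k H n \<theta> \<beta> =
     embed_pmf (\<lambda>G. if G \<in> graphs n then ergm_weight k H n \<theta> \<beta> G / ergm_Z k H n \<theta> \<beta> else 0)"

lemma finite_pairs: "finite (pairs n)"
  by (rule finite_subset[of _ "{1..n} \<times> {1..n}"]) (auto simp: pairs_def)

lemma finite_graphs: "finite (graphs n)"
  by (simp add: graphs_def finite_pairs)

lemma ergm_weight_pos: "ergm_weight k H n \<theta> \<beta> G > 0"
  by (simp add: ergm_weight_def)

lemma ergm_Z_pos: "ergm_Z k H n \<theta> \<beta> > 0"
  unfolding ergm_Z_def
  by (rule sum_pos) (auto simp: finite_graphs ergm_weight_pos, auto simp: graphs_def)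

text \<open>The argument of \<^const>\<open>embed_pmf\<close> above is a genuine probability mass function:\<close>

lemma pmf_ergm:
  "pmf (ergm k H n \<theta> \<beta>) G =
     (if G \<in> graphs n then ergm_weight k H n \<theta> \<beta> G / ergm_Z k H n \<theta> \<beta> else 0)"
  unfolding ergm_def
proof (rule pmf_embed_pmf)
  let ?f = "\<lambda>G. if G \<in> graphs n then ergm_weight k H n \<theta> \<beta> G / ergm_Z k H n \<theta> \<beta> else 0"
  show nonneg: "0 \<le> ?f x" for x
    using ergm_weight_pos[of k H n \<theta> \<beta> x] ergm_Z_pos[of k H n \<theta> \<beta>] by simp
  have "(\<integral>\<^sup>+x. ennreal (?f x) \<partial>count_space UNIV) = (\<Sum>x\<in>graphs n. ennreal (?f x))"
    by (rule nn_integral_count_space') (auto simp: finite_graphs)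
  also have "\<dots> = ennreal (\<Sum>x\<in>graphs n. ?f x)"
    by (rule sum_ennreal) (rule nonneg)
  also have "(\<Sum>x\<in>graphs n. ?f x) = 1"
    using ergm_Z_pos[of k H n \<theta> \<beta>] by (simp add: ergm_Z_def flip: sum_divide_distrib)
  finally show "(\<integral>\<^sup>+x. ennreal (?f x) \<partial>count_space UNIV) = 1" by simp
qed

lemma set_pmf_ergm: "set_pmf (ergm k H n \<theta> \<beta>) = graphs n"
  using ergm_weight_pos[of k H n \<theta> \<beta>] ergm_Z_pos[of k H n \<theta> \<beta>]
  by (auto simp: set_pmf_eq pmf_ergm less_imp_neq[symmetric] split: if_splits)

text \<open>
  The conditional expectation of the edge variable at \<open>e\<close> given all other edge variables,
  at the realisation \<open>G\<close>. For \<open>G \<in> graphs n\<close> the conditioning event contains \<open>G\<close>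
  and hence has positive probability.
\<close>

definition cond_edge_exp :: "nat \<Rightarrow> graph pmf \<Rightarrow> nat \<times> nat \<Rightarrow> graph \<Rightarrow> real" where
  "cond_edge_exp n P e G =
     measure_pmf.expectation
       (cond_pmf P {G'. \<forall>f\<in>pairs n - {e}. edge_var G' f = edge_var G f})
       (\<lambda>G'. edge_var G' e)"

definition max_test ::
    "nat \<Rightarrow> graph \<Rightarrow> nat \<Rightarrow> real \<Rightarrow> real \<Rightarrow> real \<Rightarrow> graph \<Rightarrow> nat" where
  "max_test k H n \<theta> \<beta>0 L G =
     of_bool (Max ((\<lambda>i. \<Sum>e\<in>incident_pairs n i.
                 edge_var G e - cond_edge_exp n (ergm k H n \<theta> (\<lambda>_. \<beta>0)) e G) ` {1..n}) > L)"

definition supp :: "nat \<Rightarrow> (nat \<Rightarrow> real) \<Rightarrow> nat set" where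
  "supp n \<mu> = {i \<in> {1..n}. \<mu> i \<noteq> 0}"

definition alternative :: "nat \<Rightarrow> real \<Rightarrow> nat \<Rightarrow> real \<Rightarrow> (nat \<Rightarrow> real) set" where
  "alternative n \<beta>0 s A =
     {\<beta>. \<exists>\<mu>. \<beta> = (\<lambda>i. \<beta>0 + \<mu> i) \<and> card (supp n \<mu>) \<ge> s \<and> (\<forall>i\<in>supp n \<mu>. \<mu> i \<ge> A)}"

end

theory Submission
  imports Defs
begin

text \<open>
  Conditioning removes the normalizing constant: given all other edges, the edge \<open>e = (i, j)\<close> is
  present with probability \<open>logistic (D e + \<beta> i + \<beta> j)\<close>, where \<open>D e\<close> is the discrete derivative of the
  subgraph term. Counting injections whose range contains prescribed vertices shows that \<open>D e\<close> lies in
  a bounded interval and that changing one edge at a vertex alters the \<open>D e\<close> of another edge at that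
  vertex by \<open>O(1/n)\<close>.

  Consequently the statistic at vertex \<open>i\<close>, recentred with the conditional means under the true \<open>\<beta>\<close>,
  is a sum of \<open>n - 1\<close> conditionally centred terms that changes by \<open>O(1)\<close> when one edge at \<open>i\<close> is
  resampled. Bounding the derivative of its moment generating function \<open>M\<close> by \<open>O(n) t M(t)\<close>
  yields a subgaussian tail at scale \<open>sqrt n\<close>, uniformly in \<open>\<beta>\<close>. Under the alternative some
  vertex \<open>i\<close> has \<open>\<beta> i \<ge> \<beta>0 + A\<close> while no parameter is smaller than \<open>\<beta>0\<close>, so replacing
  the true conditional means by the null ones raises the statistic by at least a constant times
  \<open>n min(A, 1)\<close>.
\<close>

subsection \<open>The logistic function\<close>

definition logistic :: "real \<Rightarrow> real" where
  "logistic x = 1 / (1 + exp (- x))"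

lemma logistic_pos: "0 < logistic x"
  by (simp add: logistic_def add_pos_pos)

lemma logistic_less_1: "logistic x < 1"
  by (simp add: logistic_def add_pos_pos)

lemma logistic_uminus: "logistic (- x) = 1 - logistic x"
proof -
  have "1 + exp x > 0" "1 + exp (- x) > 0"
    by (simp_all add: add_pos_pos)
  then show ?thesis
    by (simp add: logistic_def exp_minus field_simps)
qed

lemma logistic_mono: "x \<le> y \<Longrightarrow> logistic x \<le> logistic y"
  by (simp add: logistic_def frac_le add_pos_pos)

lemma logistic_exp_diff: "logistic (x - y) = exp x / (exp x + exp y)"
proof -
  have "exp x + exp y > 0"
    by (simp add: add_pos_pos)
  then show ?thesis
    by (simp add: logistic_def exp_diff field_simps)
qed

text \<open>The exact factorisation serves both directions: bounding the logistic factors by 1 gives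
  the Lipschitz estimate, bounding them below on a bounded interval gives a linear lower bound on
  increments.\<close>

lemma logistic_diff:
  "logistic y - logistic x = logistic y * logistic (- x) * (1 - exp (x - y))"
proof -
  have "1 + exp (- x) > 0" "1 + exp (- y) > 0"
    by (simp_all add: add_pos_pos)
  then show ?thesis
    unfolding logistic_uminus
    by (simp add: logistic_def exp_diff exp_minus divide_simps) (simp add: algebra_simps)
qed

lemma logistic_lipschitz: "\<bar>logistic x - logistic y\<bar> \<le> \<bar>x - y\<bar>"
proof -
  have *: "logistic v - logistic u \<le> v - u" if "u \<le> v" for u v
  proof -
    have "logistic v * logistic (- u) \<le> 1"
      using logistic_pos[of v] logistic_pos[of "- u"] logistic_less_1[of v] logistic_less_1[of "- u"]
      by (simp add: mult_le_one)
    then have "logistic v - logistic u \<le> 1 * (1 - exp (u - v))"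
      unfolding logistic_diff[of v u] using that by (intro mult_right_mono) auto
    also have "\<dots> \<le> v - u" unfolding mult_1_left
      using exp_ge_add_one_self[of "u - v"] by linarith
    finally show ?thesis .
  qed
  show ?thesis
    using *[of x y] *[of y x] logistic_mono[of x y] logistic_mono[of y x] by linarith
qed

text \<open>From \<open>1 + a \<le> exp a\<close> one gets
  \<open>exp (- a) \<le> 1 / (1 + a)\<close>, and this is at most \<open>1 - a / 2\<close> because
  \<open>a * a \<le> a\<close> on the unit interval.\<close>

lemma half_le_one_minus_exp:
  fixes a :: real
  assumes "0 \<le> a" "a \<le> 1"
  shows "a / 2 \<le> 1 - exp (- a)"
proof -
  have "(1 + a) * exp (- a) \<le> exp a * exp (- a)"
    by (intro mult_right_mono exp_ge_add_one_self) auto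
  then have "exp (- a) \<le> 1 / (1 + a)"
    using assms by (simp add: exp_minus field_simps)
  moreover have "1 / (1 + a) \<le> 1 - a / 2"
  proof -
    have "a * a \<le> a" using assms by (simp add: mult_left_le)
    then show ?thesis using assms by (simp add: field_simps)
  qed
  ultimately show ?thesis by linarith
qed

text \<open>Monotonicity bounds the two logistic factors of \<open>logistic_diff\<close> at the ends
  \<open>l\<close> and \<open>u\<close>. The form \<open>x + a \<le> y\<close> admits arbitrarily
  large jumps, of which only a part \<open>a \<le> 1\<close> is exploited.\<close>

lemma logistic_increment:
  assumes "l \<le> x" "x \<le> u" "0 \<le> a" "a \<le> 1" "x + a \<le> y"
  shows "logistic l * logistic (- u) * (a / 2) \<le> logistic y - logistic x"
proof -
  have "exp (x - y) \<le> exp (- a)" using assms by simp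
  then have "a / 2 \<le> 1 - exp (x - y)"
    using half_le_one_minus_exp[OF assms(3,4)] by linarith
  then show ?thesis
    unfolding logistic_diff[of y x] using assms
    by (intro mult_mono logistic_mono mult_nonneg_nonneg less_imp_le[OF logistic_pos]) auto
qed

subsection \<open>Concentration for Gibbs weights on subsets\<close>

text \<open>Under weights \<open>exp (W G)\<close> this is the log odds that \<open>e\<close> is
  present given the rest of the configuration.\<close>

definition marginal :: "('a set \<Rightarrow> real) \<Rightarrow> 'a \<Rightarrow> 'a set \<Rightarrow> real" where
  "marginal W e G = W (insert e G) - W (G - {e})"

text \<open>A sum of residuals, each centred conditionally on the other elements. With the null
  energy as \<open>W\<close> and the edges at a vertex as \<open>S\<close> it is the statistic
  maximised by the test.\<close>

definition score :: "('a set \<Rightarrow> real) \<Rightarrow> 'a set \<Rightarrow> 'a set \<Rightarrow> real" where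
  "score W S G = (\<Sum>e\<in>S. of_bool (e \<in> G) - logistic (marginal W e G))"

lemma marginal_remove [simp]: "marginal W e (G - {e}) = marginal W e G"
  by (simp add: marginal_def)

lemma sum_Pow_remove:
  fixes g :: "'a set \<Rightarrow> real"
  assumes "finite E" "e \<in> E"
  shows "(\<Sum>G\<in>Pow E. g G) = (\<Sum>G\<in>Pow (E - {e}). g G + g (insert e G))"
proof -
  have E: "Pow E = Pow (E - {e}) \<union> insert e ` Pow (E - {e})"
    using assms(2) Pow_insert[of e "E - {e}"] by (simp add: insert_absorb)
  have "inj_on (insert e) (Pow (E - {e}))"
    by (auto simp: inj_on_def)
  moreover have "(\<Sum>G\<in>Pow E. g G) = (\<Sum>G\<in>Pow (E - {e}). g G) + (\<Sum>G\<in>insert e ` Pow (E - {e}). g G)"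
    unfolding E using assms(1) by (intro sum.union_disjoint) auto
  ultimately show ?thesis
    by (simp add: sum.reindex sum.distrib)
qed

text \<open>Pair each \<open>G\<close> avoiding \<open>e\<close> with \<open>insert e G\<close>. The
  marginal and the factor \<open>h\<close> agree on the pair, and the two weighted residuals cancel
  by the definition of the log odds.\<close>

lemma gibbs_residual_orthogonal:
  fixes W :: "'a set \<Rightarrow> real"
  assumes "finite E" "e \<in> E"
  shows "(\<Sum>G\<in>Pow E. exp (W G) * (of_bool (e \<in> G) - logistic (marginal W e G)) * h (G - {e})) = 0"
  unfolding sum_Pow_remove[OF assms]
proof (rule sum.neutral, rule ballI)
  fix G assume "G \<in> Pow (E - {e})"
  then have [simp]: "e \<notin> G" by auto
  have "exp (W G) + exp (W (insert e G)) > 0" by (simp add: add_pos_pos)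
  then show "exp (W G) * (of_bool (e \<in> G) - logistic (marginal W e G)) * h (G - {e}) +
      exp (W (insert e G)) * (of_bool (e \<in> insert e G) - logistic (marginal W e (insert e G))) *
        h (insert e G - {e}) = 0"
    by (simp add: marginal_def logistic_exp_diff field_simps)
qed

text \<open>The bound carries the factor \<open>exp x\<close> at the unperturbed point, so that the
  moment generating function itself reappears when it is summed.\<close>

lemma exp_increment_bound:
  fixes x y c :: real
  assumes "\<bar>x - y\<bar> \<le> c"
  shows "\<bar>exp x - exp y\<bar> \<le> exp x * (c * exp c)"
proof -
  have c: "c \<ge> 0" using assms by linarith
  have e: "exp x - exp y = exp x * (1 - exp (y - x))"
    by (simp add: exp_diff field_simps)
  have "1 - exp (y - x) \<le> c"
    using exp_ge_add_one_self[of "y - x"] assms by linarith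
  also have "c \<le> c * exp c" using c by (simp add: mult_le_cancel_left1)
  finally have 1: "1 - exp (y - x) \<le> c * exp c" .
  have "exp (y - x) \<le> exp c" using assms unfolding exp_le_cancel_iff by linarith
  \<comment> \<open>The right side is 1, so this rearranges to
    \<open>exp c - 1 \<le> c * exp c\<close>.\<close>
  moreover have "exp c * (1 - c) \<le> exp c * exp (- c)"
    using exp_ge_add_one_self[of "- c"] by (intro mult_left_mono) auto
  moreover have "exp c * exp (- c) = 1" by (simp add: exp_minus)
  moreover have "exp c * (1 - c) = exp c - c * exp c" by (simp add: algebra_simps)
  ultimately have 2: "exp (y - x) - 1 \<le> c * exp c" by linarith
  show ?thesis unfolding e abs_mult abs_exp_cancel using 1 2 by (intro mult_left_mono) (auto simp: abs_le_iff)
qed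

text \<open>The logistic term of \<open>e\<close> ignores whether \<open>e\<close> is present, so
  its own summand moves by at most 1. Every other summand moves by at most \<open>b\<close> since
  \<open>logistic\<close> is 1-Lipschitz, and these add up to at most \<open>D\<close>.\<close>

lemma score_remove:
  assumes "finite S" "e \<in> S"
    and b: "\<And>e'. e' \<in> S \<Longrightarrow> e' \<noteq> e \<Longrightarrow> \<bar>marginal W e' G - marginal W e' (G - {e})\<bar> \<le> b"
    and "0 \<le> b" "real (card S) * b \<le> D"
  shows "\<bar>score W S G - score W S (G - {e})\<bar> \<le> 1 + D"
proof -
  let ?t = "\<lambda>e' G. of_bool (e' \<in> G) - logistic (marginal W e' G)"
  have S: "score W S F = ?t e F + (\<Sum>e'\<in>S - {e}. ?t e' F)" for F
    unfolding score_def using assms by (simp add: sum.remove)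
  have "\<bar>(\<Sum>e'\<in>S - {e}. ?t e' G - ?t e' (G - {e}))\<bar> \<le> (\<Sum>e'\<in>S - {e}. b)"
  proof (rule order_trans[OF sum_abs], rule sum_mono)
    fix e' assume e': "e' \<in> S - {e}"
    then have "\<bar>?t e' G - ?t e' (G - {e})\<bar> =
        \<bar>logistic (marginal W e' G) - logistic (marginal W e' (G - {e}))\<bar>"
      by auto
    also have "\<dots> \<le> b"
      using b[of e'] e' by (intro order_trans[OF logistic_lipschitz]) auto
    finally show "\<bar>?t e' G - ?t e' (G - {e})\<bar> \<le> b" .
  qed
  also have "\<dots> = real (card (S - {e})) * b" by simp
  also have "\<dots> \<le> real (card S) * b"
    using assms by (intro mult_right_mono of_nat_mono card_mono) auto
  also have "\<dots> \<le> D" by fact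
  finally have "\<bar>(\<Sum>e'\<in>S - {e}. ?t e' G) - (\<Sum>e'\<in>S - {e}. ?t e' (G - {e}))\<bar> \<le> D"
    by (simp only: sum_subtractf)
  moreover have "\<bar>?t e G - ?t e (G - {e})\<bar> \<le> 1" by simp
  ultimately show ?thesis unfolding S by linarith
qed

text \<open>
  Since \<open>e\<close> is conditionally centred, \<open>exp (t * \<sigma> * score W S G)\<close> may be replaced by its increment
  on removing \<open>e\<close>, which is of order \<open>t\<close>.
\<close>

lemma score_mgf_deriv:
  fixes W :: "'a set \<Rightarrow> real" and \<sigma> t :: real
  assumes E: "finite E" and SE: "S \<subseteq> E"
    and b: "\<And>G e e'. G \<subseteq> E \<Longrightarrow> e \<in> S \<Longrightarrow> e' \<in> S \<Longrightarrow> e' \<noteq> e \<Longrightarrow>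
             \<bar>marginal W e' G - marginal W e' (G - {e})\<bar> \<le> b"
    and b0: "0 \<le> b" and D: "real (card S) * b \<le> D"
    and \<sigma>: "\<bar>\<sigma>\<bar> = 1" and t: "0 \<le> t" "t \<le> 1"
  defines "K \<equiv> 1 + D"
  shows "(\<Sum>G\<in>Pow E. exp (W G) * (\<sigma> * score W S G * exp (t * (\<sigma> * score W S G))))
    \<le> real (card S) * (K * exp K) * t * (\<Sum>G\<in>Pow E. exp (W G) * exp (t * (\<sigma> * score W S G)))"
proof -
  let ?f = "\<lambda>G. t * (\<sigma> * score W S G)"
  let ?r = "\<lambda>e G. of_bool (e \<in> G) - logistic (marginal W e G)"
  let ?M = "\<Sum>G\<in>Pow E. exp (W G) * exp (?f G)"
  have finS: "finite S" using E SE finite_subset by blast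
  have distrib: "a * (\<sigma> * sum r S * c) = (\<Sum>e\<in>S. \<sigma> * (a * r e * c))" for a c and r :: "'a \<Rightarrow> real"
    by (simp add: sum_distrib_left sum_distrib_right mult_ac)
  have K0: "K \<ge> 1"
    using mult_nonneg_nonneg[OF of_nat_0_le_iff b0, of "card S"] D unfolding K_def by linarith
  have "(\<Sum>G\<in>Pow E. exp (W G) * (\<sigma> * score W S G * exp (?f G))) =
      (\<Sum>e\<in>S. \<sigma> * (\<Sum>G\<in>Pow E. exp (W G) * ?r e G * exp (?f G)))"
    unfolding sum_distrib_left
    by (subst sum.swap, rule sum.cong[OF refl], unfold score_def, rule distrib)
  also have "\<dots> \<le> (\<Sum>e\<in>S. (t * (K * exp K)) * ?M)"
  proof (rule sum_mono)
    fix e assume e: "e \<in> S"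
    have diff: "\<bar>exp (?f G) - exp (?f (G - {e}))\<bar> \<le> exp (?f G) * (t * (K * exp K))"
      if "G \<in> Pow E" for G
    proof -
      have "\<bar>score W S G - score W S (G - {e})\<bar> \<le> K"
        unfolding K_def using that e by (intro score_remove[OF finS e b b0 D]) auto
      then have "\<bar>?f G - ?f (G - {e})\<bar> \<le> t * K"
        using t \<sigma> by (simp add: abs_mult mult_left_mono flip: right_diff_distrib)
      then have "\<bar>exp (?f G) - exp (?f (G - {e}))\<bar> \<le> exp (?f G) * (t * K * exp (t * K))"
        by (rule exp_increment_bound)
      \<comment> \<open>Using \<open>t \<le> 1\<close> inside the exponential only leaves a bound
        linear in \<open>t\<close>.\<close>
      also have "\<dots> \<le> exp (?f G) * (t * K * exp K)"
        using t K0 mult_right_mono[of t 1 K] by (intro mult_left_mono) auto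
      finally show ?thesis by (simp add: mult_ac)
    qed
    have eq: "(\<Sum>G\<in>Pow E. exp (W G) * ?r e G * exp (?f G)) =
        (\<Sum>G\<in>Pow E. exp (W G) * ?r e G * (exp (?f G) - exp (?f (G - {e}))))"
      using gibbs_residual_orthogonal[OF E, of e W "\<lambda>G. exp (?f G)"] e SE
      by (simp add: right_diff_distrib sum_subtractf subset_iff)
    have "\<bar>\<Sum>G\<in>Pow E. exp (W G) * ?r e G * exp (?f G)\<bar>
        \<le> (\<Sum>G\<in>Pow E. exp (W G) * (exp (?f G) * (t * (K * exp K))))"
      unfolding eq
    proof (rule order_trans[OF sum_abs], rule sum_mono)
      fix G assume G: "G \<in> Pow E"
      have "\<bar>?r e G\<bar> \<le> 1"
        using logistic_pos[of "marginal W e G"] logistic_less_1[of "marginal W e G"] by auto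
      then have "exp (W G) * (\<bar>?r e G\<bar> * \<bar>exp (?f G) - exp (?f (G - {e}))\<bar>)
          \<le> exp (W G) * (1 * (exp (?f G) * (t * (K * exp K))))"
        by (intro mult_left_mono mult_mono diff[OF G]) auto
      then show "\<bar>exp (W G) * ?r e G * (exp (?f G) - exp (?f (G - {e})))\<bar>
          \<le> exp (W G) * (exp (?f G) * (t * (K * exp K)))"
        by (simp add: abs_mult mult_ac)
    qed
    also have "\<dots> = (t * (K * exp K)) * ?M"
      unfolding sum_distrib_left by (intro sum.cong refl) (simp only: mult_ac)
    finally have "\<bar>\<sigma> * (\<Sum>G\<in>Pow E. exp (W G) * ?r e G * exp (?f G))\<bar> \<le> (t * (K * exp K)) * ?M"
      using \<sigma> by (simp add: abs_mult)
    then show "\<sigma> * (\<Sum>G\<in>Pow E. exp (W G) * ?r e G * exp (?f G)) \<le> (t * (K * exp K)) * ?M"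
      by linarith
  qed
  also have "\<dots> = real (card S) * (K * exp K) * t * ?M" by (simp add: mult_ac)
  finally show ?thesis .
qed

text \<open>Integrating factor: \<open>M x * exp (- (a * x\<^sup>2 / 2))\<close> has nonpositive
  derivative on \<open>[0, t]\<close>.\<close>

lemma gronwall_square:
  fixes M M' :: "real \<Rightarrow> real"
  assumes d: "\<And>x. (M has_real_derivative M' x) (at x)"
    and le: "\<And>x. 0 \<le> x \<Longrightarrow> x \<le> 1 \<Longrightarrow> M' x \<le> a * x * M x"
    and t: "0 \<le> t" "t \<le> 1"
  shows "M t \<le> M 0 * exp (a * t\<^sup>2 / 2)"
proof -
  have "M t * exp (- (a * t\<^sup>2 / 2)) \<le> M 0 * exp (- (a * 0\<^sup>2 / 2))"
  proof (rule DERIV_nonpos_imp_nonincreasing[OF t(1)])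
    fix x assume x: "0 \<le> x" "x \<le> t"
    have "((\<lambda>x. M x * exp (- (a * x\<^sup>2 / 2))) has_real_derivative
        (M' x - a * x * M x) * exp (- (a * x\<^sup>2 / 2))) (at x)"
      by (auto intro!: derivative_eq_intros d simp: algebra_simps)
    moreover have "(M' x - a * x * M x) * exp (- (a * x\<^sup>2 / 2)) \<le> 0"
      using le[of x] x t by (simp add: mult_le_0_iff)
    ultimately show "\<exists>y. ((\<lambda>x. M x * exp (- (a * x\<^sup>2 / 2))) has_real_derivative y) (at x) \<and> y \<le> 0"
      by blast
  qed
  then show ?thesis by (simp add: exp_minus field_simps)
qed

text \<open>The sums are left unnormalised, so the value at 0 is the partition sum. The sign
  \<open>\<sigma>\<close> handles both tails at once.\<close>

lemma score_mgf:
  fixes W :: "'a set \<Rightarrow> real" and \<sigma> t :: real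
  assumes E: "finite E" and SE: "S \<subseteq> E"
    and b: "\<And>G e e'. G \<subseteq> E \<Longrightarrow> e \<in> S \<Longrightarrow> e' \<in> S \<Longrightarrow> e' \<noteq> e \<Longrightarrow>
             \<bar>marginal W e' G - marginal W e' (G - {e})\<bar> \<le> b"
    and b0: "0 \<le> b" and D: "real (card S) * b \<le> D"
    and \<sigma>: "\<bar>\<sigma>\<bar> = 1" and t: "0 \<le> t" "t \<le> 1"
  defines "K \<equiv> 1 + D"
  shows "(\<Sum>G\<in>Pow E. exp (W G) * exp (t * (\<sigma> * score W S G)))
    \<le> (\<Sum>G\<in>Pow E. exp (W G)) * exp (real (card S) * (K * exp K) * t\<^sup>2 / 2)"
proof -
  let ?M = "\<lambda>x. \<Sum>G\<in>Pow E. exp (W G) * exp (x * (\<sigma> * score W S G))"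
  let ?M' = "\<lambda>x. \<Sum>G\<in>Pow E. exp (W G) * (\<sigma> * score W S G * exp (x * (\<sigma> * score W S G)))"
  have "?M t \<le> ?M 0 * exp (real (card S) * (K * exp K) * t\<^sup>2 / 2)"
  proof (rule gronwall_square[OF _ _ t])
    show "(?M has_real_derivative ?M' x) (at x)" for x
    proof (rule DERIV_sum)
      fix G
      show "((\<lambda>x. exp (W G) * exp (x * (\<sigma> * score W S G))) has_real_derivative
          exp (W G) * (\<sigma> * score W S G * exp (x * (\<sigma> * score W S G)))) (at x)"
        by (auto intro!: derivative_eq_intros)
    qed
    show "?M' x \<le> real (card S) * (K * exp K) * x * ?M x" if "0 \<le> x" "x \<le> 1" for x
      unfolding K_def using score_mgf_deriv[OF E SE b b0 D \<sigma> that] by blast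
  qed
  then show ?thesis by simp
qed

text \<open>Markov's inequality applied to \<open>exp (t * (\<sigma> * score W S G))\<close>, again
  without normalisation.\<close>

lemma score_tail:
  fixes W :: "'a set \<Rightarrow> real" and \<sigma> t :: real
  assumes E: "finite E" and SE: "S \<subseteq> E"
    and b: "\<And>G e e'. G \<subseteq> E \<Longrightarrow> e \<in> S \<Longrightarrow> e' \<in> S \<Longrightarrow> e' \<noteq> e \<Longrightarrow>
             \<bar>marginal W e' G - marginal W e' (G - {e})\<bar> \<le> b"
    and b0: "0 \<le> b" and D: "real (card S) * b \<le> D"
    and \<sigma>: "\<bar>\<sigma>\<bar> = 1" and t: "0 \<le> t" "t \<le> 1"
  defines "K \<equiv> 1 + D"
  shows "(\<Sum>G | G \<subseteq> E \<and> c \<le> \<sigma> * score W S G. exp (W G))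
    \<le> (\<Sum>G\<in>Pow E. exp (W G)) * exp (real (card S) * (K * exp K) * t\<^sup>2 / 2 - t * c)"
proof -
  have "(\<Sum>G | G \<subseteq> E \<and> c \<le> \<sigma> * score W S G. exp (W G)) * exp (t * c)
      \<le> (\<Sum>G | G \<subseteq> E \<and> c \<le> \<sigma> * score W S G. exp (W G) * exp (t * (\<sigma> * score W S G)))"
    unfolding sum_distrib_right
  proof (rule sum_mono)
    fix G assume "G \<in> {G. G \<subseteq> E \<and> c \<le> \<sigma> * score W S G}"
    then have "t * c \<le> t * (\<sigma> * score W S G)"
      using t by (intro mult_left_mono) auto
    then show "exp (W G) * exp (t * c) \<le> exp (W G) * exp (t * (\<sigma> * score W S G))"
      by simp
  qed
  also have "\<dots> \<le> (\<Sum>G\<in>Pow E. exp (W G) * exp (t * (\<sigma> * score W S G)))"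
    using E by (intro sum_mono2) auto
  also have "\<dots> \<le> (\<Sum>G\<in>Pow E. exp (W G)) * exp (real (card S) * (K * exp K) * t\<^sup>2 / 2)"
    unfolding K_def using score_mgf[OF E SE b b0 D \<sigma> t] by blast
  finally show ?thesis unfolding exp_diff times_divide_eq_right by (simp only: pos_le_divide_eq exp_gt_zero)
qed

subsection \<open>Discrete derivatives of subgraph counts\<close>

text \<open>Choosing one preimage for each point of \<open>V\<close> gives an injection
  \<open>h\<close> from \<open>V\<close> into \<open>{1..k}\<close>. There are at most
  \<open>k ^ card V\<close> of these, and each leaves \<open>n\<close> free values at the
  \<open>k - card V\<close> points outside its range.\<close>

lemma card_maps_covering_le:
  fixes k n :: nat
  assumes "finite V" "card V \<le> k"
  shows "card {\<iota> \<in> {1..k} \<rightarrow>\<^sub>E {1..n}. V \<subseteq> \<iota> ` {1..k}} \<le> k ^ card V * n ^ (k - card V)"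
proof -
  \<comment> \<open>For injective \<open>h\<close>, the maps sending \<open>h v\<close> back to
    \<open>v\<close> for all \<open>v\<close> in \<open>V\<close>, arbitrary elsewhere.\<close>
  let ?X = "\<lambda>h. PiE {1..k} (\<lambda>a. if a \<in> h ` V then {the_inv_into V h a} else {1..n})"
  let ?H = "{h \<in> V \<rightarrow>\<^sub>E {1..k}. inj_on h V}"
  have fin: "finite (V \<rightarrow>\<^sub>E {1..k})" using assms by (intro finite_PiE) auto
  have card_X: "card (?X h) = n ^ (k - card V)" if h: "h \<in> ?H" for h
  proof -
    have hV: "h ` V \<subseteq> {1..k}" using h by auto
    have "card (?X h) = (\<Prod>a\<in>{1..k}. if a \<in> h ` V then 1 else n)"
      by (simp add: card_PiE if_distrib cong: if_cong)
    also have "\<dots> = (\<Prod>a\<in>{1..k} - h ` V. n)"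
      by (rule prod.mono_neutral_cong_right) auto
    also have "\<dots> = n ^ (k - card V)"
      using h hV assms by (simp add: card_Diff_subset card_image)
    finally show ?thesis .
  qed
  have "{\<iota> \<in> {1..k} \<rightarrow>\<^sub>E {1..n}. V \<subseteq> \<iota> ` {1..k}} \<subseteq> (\<Union>h\<in>?H. ?X h)"
  proof
    fix \<iota> assume \<iota>: "\<iota> \<in> {\<iota> \<in> {1..k} \<rightarrow>\<^sub>E {1..n}. V \<subseteq> \<iota> ` {1..k}}"
    define h where "h = restrict (inv_into {1..k} \<iota>) V"
    have "inv_into {1..k} \<iota> v \<in> {1..k}" if "v \<in> V" for v
      using \<iota> that by (intro inv_into_into) blast
    then have h: "h \<in> V \<rightarrow>\<^sub>E {1..k}"
      unfolding h_def by simp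
    have \<iota>h: "\<iota> (h v) = v" if "v \<in> V" for v
      using \<iota> that unfolding h_def by (auto intro!: f_inv_into_f)
    have inj: "inj_on h V" using \<iota>h by (metis inj_onI)
    have "\<iota> \<in> ?X h"
      using \<iota> \<iota>h inj by (auto simp: PiE_iff the_inv_into_f_f)
    then show "\<iota> \<in> (\<Union>h\<in>?H. ?X h)" using h inj by blast
  qed
  then have "card {\<iota> \<in> {1..k} \<rightarrow>\<^sub>E {1..n}. V \<subseteq> \<iota> ` {1..k}} \<le> card (\<Union>h\<in>?H. ?X h)"
    using fin by (intro card_mono finite_UN_I finite_PiE) (auto intro: finite_subset[OF _ fin])
  also have "\<dots> \<le> (\<Sum>h\<in>?H. card (?X h))"
    using fin by (intro card_UN_le) (auto intro: finite_subset[OF _ fin])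
  also have "\<dots> = card ?H * n ^ (k - card V)"
    using card_X by simp
  also have "\<dots> \<le> card (V \<rightarrow>\<^sub>E {1..k}) * n ^ (k - card V)"
    using fin by (intro mult_right_mono card_mono) auto
  also have "card (V \<rightarrow>\<^sub>E {1..k}) = k ^ card V"
    using assms by (simp add: card_PiE)
  finally show ?thesis .
qed

text \<open>Endpoints are sorted because graphs store each edge with its smaller vertex first. The
  product of adjacency entries then becomes the indicator of an inclusion in
  \<open>G\<close>.\<close>

definition image_edges :: "graph \<Rightarrow> (nat \<Rightarrow> nat) \<Rightarrow> graph" where
  "image_edges H \<iota> = (\<lambda>(i, j). (min (\<iota> i) (\<iota> j), max (\<iota> i) (\<iota> j))) ` H"

lemma prod_of_bool:
  "finite A \<Longrightarrow> (\<Prod>x\<in>A. of_bool (P x)) = (of_bool (\<forall>x\<in>A. P x) :: real)"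
  by (induction A rule: finite_induct) auto

abbreviation embeddings :: "nat \<Rightarrow> nat \<Rightarrow> (nat \<Rightarrow> nat) set" where
  "embeddings k n \<equiv> {\<iota> \<in> {1..k} \<rightarrow>\<^sub>E {1..n}. inj_on \<iota> {1..k}}"

lemma image_edges_cover:
  assumes "H \<in> graphs k" "e \<in> image_edges H \<iota>"
  shows "{fst e, snd e} \<subseteq> \<iota> ` {1..k}"
  using assms by (fastforce simp: image_edges_def graphs_def pairs_def min_def max_def split: if_splits)

lemma subgraph_count_alt:
  assumes G: "G \<in> graphs n" and H: "H \<in> graphs k"
  shows "subgraph_count k H n G = (\<Sum>\<iota>\<in>embeddings k n. of_bool (image_edges H \<iota> \<subseteq> G))"
  unfolding subgraph_count_def
proof (rule sum.cong[OF refl])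
  fix \<iota> assume \<iota>: "\<iota> \<in> embeddings k n"
  have finH: "finite H"
    using H finite_pairs finite_subset unfolding graphs_def by blast
  have "adj G (\<iota> i) (\<iota> j) = of_bool ((min (\<iota> i) (\<iota> j), max (\<iota> i) (\<iota> j)) \<in> G)" if "(i, j) \<in> H" for i j
    using G that by (auto simp: adj_def graphs_def pairs_def min_def max_def)
  then have "(\<Prod>(i, j)\<in>H. adj G (\<iota> i) (\<iota> j)) =
      (\<Prod>e\<in>H. of_bool ((\<lambda>(i, j). (min (\<iota> i) (\<iota> j), max (\<iota> i) (\<iota> j))) e \<in> G))"
    by (intro prod.cong) auto
  also have "\<dots> = of_bool (image_edges H \<iota> \<subseteq> G)"
    by (subst prod_of_bool[OF finH]) (auto simp: image_edges_def)
  finally show "(\<Prod>(i, j)\<in>H. adj G (\<iota> i) (\<iota> j)) = of_bool (image_edges H \<iota> \<subseteq> G)" .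
qed

text \<open>An image avoiding \<open>e\<close> lies in \<open>insert e G\<close> iff it lies in
  \<open>G - {e}\<close>, so its two indicators cancel; an image containing \<open>e\<close> never
  lies in \<open>G - {e}\<close>.\<close>

lemma marginal_subgraph_count:
  assumes G: "G \<in> graphs n" and H: "H \<in> graphs k" and e: "e \<in> pairs n"
  shows "marginal (subgraph_count k H n) e G =
    (\<Sum>\<iota>\<in>embeddings k n. of_bool (e \<in> image_edges H \<iota> \<and> image_edges H \<iota> \<subseteq> insert e G))"
proof -
  have "insert e G \<in> graphs n" "G - {e} \<in> graphs n"
    using G e by (auto simp: graphs_def)
  then show ?thesis
    unfolding marginal_def by (simp only: subgraph_count_alt[OF _ H] flip: sum_subtractf)
      (intro sum.cong, auto)
qed

text \<open>A contributing embedding must cover both endpoints of \<open>e\<close>. Prescribing two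
  vertices costs a factor of order \<open>n ^ 2\<close>, which matches the normalisation of the
  model.\<close>

lemma marginal_subgraph_count_bounds:
  assumes G: "G \<in> graphs n" and H: "H \<in> graphs k" and e: "e \<in> pairs n" and k: "k \<ge> 2"
  shows "0 \<le> marginal (subgraph_count k H n) e G"
    and "marginal (subgraph_count k H n) e G \<le> real k ^ 2 * real n ^ (k - 2)"
proof -
  show "0 \<le> marginal (subgraph_count k H n) e G"
    unfolding marginal_subgraph_count[OF G H e] by (intro sum_nonneg) auto
  let ?V = "{fst e, snd e}"
  have V: "card ?V = 2" using e by (auto simp: pairs_def)
  have "marginal (subgraph_count k H n) e G \<le>
      (\<Sum>\<iota>\<in>embeddings k n. of_bool (?V \<subseteq> \<iota> ` {1..k}))"
    unfolding marginal_subgraph_count[OF G H e]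
    using image_edges_cover[OF H, of e] by (intro sum_mono) (auto simp: of_bool_def)
  also have "\<dots> \<le> (\<Sum>\<iota>\<in>{1..k} \<rightarrow>\<^sub>E {1..n}. of_bool (?V \<subseteq> \<iota> ` {1..k}))"
    by (intro sum_mono2 finite_PiE) auto
  also have "\<dots> = real (card {\<iota> \<in> {1..k} \<rightarrow>\<^sub>E {1..n}. ?V \<subseteq> \<iota> ` {1..k}})"
    by (subst sum_of_bool_eq) (auto intro: finite_PiE simp: Int_def)
  also have "\<dots> \<le> real (k ^ card ?V * n ^ (k - card ?V))"
    using V k by (intro of_nat_mono card_maps_covering_le) auto
  finally show "marginal (subgraph_count k H n) e G \<le> real k ^ 2 * real n ^ (k - 2)"
    unfolding V by simp
qed

lemma incident_pairs_other:
  assumes "e \<in> incident_pairs n i"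
  obtains j where "{fst e, snd e} = {i, j}" "j \<noteq> i" "e = (min i j, max i j)"
proof (cases "i = fst e")
  case True
  with assms show ?thesis by (intro that[of "snd e"]) (auto simp: incident_pairs_def pairs_def)
next
  case False
  with assms show ?thesis by (intro that[of "fst e"]) (auto simp: incident_pairs_def pairs_def)
qed

text \<open>An affected embedding uses both edges, and two distinct edges at \<open>i\<close> span
  three vertices. This saves one more factor \<open>n\<close>, written on the left because
  \<open>k - 3\<close> truncates when \<open>k = 2\<close>.\<close>

lemma marginal_subgraph_count_remove:
  assumes G: "G \<in> graphs n" and H: "H \<in> graphs k"
    and e: "e \<in> incident_pairs n i" "e' \<in> incident_pairs n i" "e' \<noteq> e" and k: "k \<ge> 2"
  shows "real n * \<bar>marginal (subgraph_count k H n) e' G - marginal (subgraph_count k H n) e' (G - {e})\<bar>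
    \<le> real k ^ 3 * real n ^ (k - 2)"
proof -
  let ?V = "{fst e, snd e} \<union> {fst e', snd e'}"
  let ?A = "{\<iota> \<in> {1..k} \<rightarrow>\<^sub>E {1..n}. ?V \<subseteq> \<iota> ` {1..k}}"
  have ep: "e \<in> pairs n" "e' \<in> pairs n" using e by (auto simp: incident_pairs_def)
  have V: "card ?V = 3"
  proof -
    obtain x where x: "{fst e, snd e} = {i, x}" "x \<noteq> i" "e = (min i x, max i x)"
      using incident_pairs_other[OF e(1)] .
    obtain y where y: "{fst e', snd e'} = {i, y}" "y \<noteq> i" "e' = (min i y, max i y)"
      using incident_pairs_other[OF e(2)] .
    have "?V = {i, x, y}" "x \<noteq> y" using x y e(3) by auto
    then show ?thesis using x(2) y(2) by simp
  qed
  have G': "G - {e} \<in> graphs n" using G by (auto simp: graphs_def)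
  let ?t = "\<lambda>G \<iota>. of_bool (e' \<in> image_edges H \<iota> \<and> image_edges H \<iota> \<subseteq> insert e' G) :: real"
  have "\<bar>marginal (subgraph_count k H n) e' G - marginal (subgraph_count k H n) e' (G - {e})\<bar>
      \<le> (\<Sum>\<iota>\<in>embeddings k n. \<bar>?t G \<iota> - ?t (G - {e}) \<iota>\<bar>)"
    unfolding marginal_subgraph_count[OF G H ep(2)] marginal_subgraph_count[OF G' H ep(2)]
    by (subst sum_subtractf[symmetric]) (rule sum_abs)
  also have "\<dots> \<le> (\<Sum>\<iota>\<in>embeddings k n. of_bool (?V \<subseteq> \<iota> ` {1..k}))"
  proof (rule sum_mono)
    fix \<iota>
    have "?V \<subseteq> \<iota> ` {1..k}" if "?t G \<iota> \<noteq> ?t (G - {e}) \<iota>"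
    proof -
      from that have "e' \<in> image_edges H \<iota>" "e \<in> image_edges H \<iota>" by (auto simp: of_bool_def split: if_splits)
      then show ?thesis using image_edges_cover[OF H] by (metis Un_least)
    qed
    then show "\<bar>?t G \<iota> - ?t (G - {e}) \<iota>\<bar> \<le> of_bool (?V \<subseteq> \<iota> ` {1..k})"
      by (auto simp: of_bool_def)
  qed
  also have "\<dots> \<le> (\<Sum>\<iota>\<in>{1..k} \<rightarrow>\<^sub>E {1..n}. of_bool (?V \<subseteq> \<iota> ` {1..k}))"
    by (intro sum_mono2 finite_PiE) auto
  also have "\<dots> = real (card ?A)"
    by (subst sum_of_bool_eq) (auto intro: finite_PiE simp: Int_def)
  finally have *: "real n * \<bar>marginal (subgraph_count k H n) e' G - marginal (subgraph_count k H n) e' (G - {e})\<bar>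
      \<le> real n * real (card ?A)"
    by (intro mult_left_mono) auto
  have "n * card ?A \<le> k ^ 3 * n ^ (k - 2)"
  \<comment> \<open>The counting bound needs \<open>card ?V \<le> k\<close>; for
    \<open>k = 2\<close> no map covers three vertices at all.\<close>
  proof (cases "k = 2")
    case True
    have "?A = {}"
    proof (safe, goal_cases)
      case (1 \<iota>)
      then have "card ?V \<le> card (\<iota> ` {1..k})" by (intro card_mono) auto
      also have "\<dots> \<le> k" using card_image_le[of "{1..k}" \<iota>] by simp
      finally show ?case using V True by simp
    qed
    then show ?thesis by (simp only: card.empty mult_0_right le0)
  next
    case False
    then have k3: "k \<ge> 3" using k by simp
    have "card ?A \<le> k ^ 3 * n ^ (k - 3)"
      using card_maps_covering_le[of ?V k n] k3 unfolding V by simp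
    then have "n * card ?A \<le> k ^ 3 * (n * n ^ (k - 3))" by (simp add: mult.left_commute)
    also have "n * n ^ (k - 3) = n ^ (k - 2)"
    proof -
      have "k - 2 = Suc (k - 3)" using k3 by simp
      then show ?thesis by simp
    qed
    finally show ?thesis .
  qed
  then have "real (n * card ?A) \<le> real (k ^ 3 * n ^ (k - 2))" by (rule of_nat_mono)
  with * show ?thesis by simp
qed

subsection \<open>The degree corrected model\<close>

definition ergm_energy :: "nat \<Rightarrow> graph \<Rightarrow> nat \<Rightarrow> real \<Rightarrow> (nat \<Rightarrow> real) \<Rightarrow> graph \<Rightarrow> real" where
  "ergm_energy k H n \<theta> \<beta> G =
     \<theta> / real n ^ (k - 2) * subgraph_count k H n G + (\<Sum>i\<in>{1..n}. \<beta> i * deg n G i)"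

lemma ergm_weight_eq: "ergm_weight k H n \<theta> \<beta> G = exp (ergm_energy k H n \<theta> \<beta> G)"
  by (simp add: ergm_weight_def ergm_energy_def)

lemma marginal_degree:
  assumes G: "G \<in> graphs n" and e: "e \<in> pairs n"
  shows "marginal (\<lambda>G. \<Sum>i\<in>{1..n}. \<beta> i * deg n G i) e G = \<beta> (fst e) + \<beta> (snd e)"
proof -
  obtain a b where ab: "e = (a, b)" "1 \<le> a" "a < b" "b \<le> n"
    using e by (auto simp: pairs_def)
  \<comment> \<open>Without the reversed pair, deleting \<open>e\<close> really makes the adjacency
    entries of \<open>a\<close> and \<open>b\<close> vanish.\<close>
  have ba: "(b, a) \<notin> G" using G ab by (auto simp: graphs_def pairs_def)
  have d: "adj (insert e G) i j - adj (G - {e}) i j =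
      of_bool (i = a) * of_bool (j = b) + of_bool (i = b) * of_bool (j = a)" for i j
  proof -
    consider "i = a" "j = b" | "i = b" "j = a" | "(i, j) \<noteq> e" "(j, i) \<noteq> e"
      using ab(1) by auto
    then show ?thesis
    proof cases
      case 3
      then have "\<not> (i = a \<and> j = b)" "\<not> (i = b \<and> j = a)" using ab(1) by auto
      with 3 show ?thesis by (auto simp: adj_def)
    qed (use ab(1,3) ba in \<open>simp_all add: adj_def\<close>)
  qed
  have "marginal (\<lambda>G. \<Sum>i\<in>{1..n}. \<beta> i * deg n G i) e G =
      (\<Sum>i\<in>{1..n}. \<beta> i * (\<Sum>j\<in>{1..n}. adj (insert e G) i j - adj (G - {e}) i j))"
    unfolding marginal_def deg_def by (simp add: sum_subtractf right_diff_distrib)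
  also have "\<dots> = (\<Sum>i\<in>{1..n}. \<beta> i *
      (\<Sum>j\<in>{1..n}. of_bool (i = a) * of_bool (j = b) + of_bool (i = b) * of_bool (j = a)))"
    unfolding d ..
  also have "\<dots> = (\<Sum>i\<in>{1..n}. \<beta> i * (of_bool (i = a) + of_bool (i = b)))"
  proof -
    have "(\<Sum>j\<in>{1..n}. of_bool (j = c)) = (1 :: real)" if "1 \<le> c" "c \<le> n" for c
      using that by (simp add: of_bool_def)
    with ab show ?thesis
      by (simp add: sum.distrib flip: sum_distrib_left)
  qed
  also have "\<dots> = \<beta> a + \<beta> b"
    using ab by (simp add: distrib_left sum.distrib)
  finally show ?thesis using ab by simp
qed

lemma marginal_energy:
  assumes "G \<in> graphs n" "e \<in> pairs n"
  shows "marginal (ergm_energy k H n \<theta> \<beta>) e G =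
    \<theta> / real n ^ (k - 2) * marginal (subgraph_count k H n) e G + (\<beta> (fst e) + \<beta> (snd e))"
  unfolding marginal_degree[OF assms, symmetric]
  by (simp add: marginal_def ergm_energy_def algebra_simps)

text \<open>The conditioning event meets the support in just \<open>insert e G\<close> and
  \<open>G - {e}\<close>. The normalizing constant cancels, and the ratio of weights that remains
  depends only on the energy difference.\<close>

lemma cond_edge_exp_ergm:
  assumes G: "G \<in> graphs n" and e: "e \<in> pairs n"
  shows "cond_edge_exp n (ergm k H n \<theta> \<beta>) e G = logistic (marginal (ergm_energy k H n \<theta> \<beta>) e G)"
proof -
  let ?P = "ergm k H n \<theta> \<beta>"
  let ?s = "{G'. \<forall>f\<in>pairs n - {e}. edge_var G' f = edge_var G f}"
  let ?w = "ergm_weight k H n \<theta> \<beta>" and ?Z = "ergm_Z k H n \<theta> \<beta>"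
  have ev: "edge_var F f = of_bool (f \<in> F)" if "F \<in> graphs n" "f \<in> pairs n" for F f
    using that by (auto simp: edge_var_def adj_def graphs_def pairs_def)
  have g: "insert e G \<in> graphs n" "G - {e} \<in> graphs n"
    using G e by (auto simp: graphs_def)
  have s: "graphs n \<inter> ?s = {insert e G, G - {e}}"
  proof (rule equalityI; rule subsetI)
    fix F assume F: "F \<in> graphs n \<inter> ?s"
    have iff: "f \<in> F \<longleftrightarrow> f \<in> G" if "f \<in> pairs n - {e}" for f
    proof -
      have "edge_var F f = edge_var G f" using F that by blast
      then show ?thesis using ev[of F f] ev[OF G, of f] F that by (simp add: of_bool_eq_iff)
    qed
    have "F \<subseteq> pairs n" "G \<subseteq> pairs n" using F G by (auto simp: graphs_def)
    with iff have "F - {e} = G - {e}" by blast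
    then show "F \<in> {insert e G, G - {e}}"
      by (cases "e \<in> F") (metis insertI1 insert_Diff_single insert_absorb,
        metis Diff_empty Diff_insert0 insertCI)
  next
    fix F assume "F \<in> {insert e G, G - {e}}"
    then have F: "F \<in> graphs n" "\<And>f. f \<noteq> e \<Longrightarrow> f \<in> F \<longleftrightarrow> f \<in> G" using g by blast+
    then have "edge_var F f = edge_var G f" if "f \<in> pairs n - {e}" for f
      using that ev[of F f] ev[OF G, of f] by simp
    then show "F \<in> graphs n \<inter> ?s" using F by blast
  qed
  have ne: "set_pmf ?P \<inter> ?s \<noteq> {}" by (simp add: set_pmf_ergm s)
  have dist: "insert e G \<noteq> G - {e}" by auto
  have meas: "measure ?P ?s = (?w (insert e G) + ?w (G - {e})) / ?Z"
  proof -
    have "measure ?P ?s = measure ?P (?s \<inter> set_pmf ?P)" by (simp add: measure_Int_set_pmf)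
    also have "?s \<inter> set_pmf ?P = {insert e G, G - {e}}" using s by (simp add: set_pmf_ergm Int_commute)
    finally show ?thesis
      using g dist by (simp add: measure_measure_pmf_finite pmf_ergm add_divide_distrib)
  qed
  have "cond_edge_exp n ?P e G =
      (\<Sum>F\<in>{insert e G, G - {e}}. edge_var F e * pmf (cond_pmf ?P ?s) F)"
    unfolding cond_edge_exp_def
    by (rule integral_measure_pmf_real) (auto simp: set_cond_pmf[OF ne] set_pmf_ergm s simp del: Int_iff)
  also have "\<dots> = pmf (cond_pmf ?P ?s) (insert e G)"
    using dist g e by (simp add: ev)
  also have "\<dots> = ?w (insert e G) / (?w (insert e G) + ?w (G - {e}))"
  proof -
    have "insert e G \<in> ?s" using s by blast
    then show ?thesis
      using g ergm_Z_pos[of k H n \<theta> \<beta>] by (simp only: pmf_cond[OF ne] meas pmf_ergm) simp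
  qed
  finally show ?thesis
    by (simp add: marginal_def logistic_exp_diff ergm_weight_eq)
qed

text \<open>Identifies the test with scores of the null energy; \<open>n \<ge> 1\<close> makes the
  maximum range over a nonempty set.\<close>

lemma max_test_eq_1_iff:
  assumes G: "G \<in> graphs n" and n: "n \<ge> 1"
  shows "max_test k H n \<theta> \<beta>0 L G = 1 \<longleftrightarrow>
    (\<exists>i\<in>{1..n}. L < score (ergm_energy k H n \<theta> (\<lambda>_. \<beta>0)) (incident_pairs n i) G)"
proof -
  have "(\<Sum>e\<in>incident_pairs n i. edge_var G e - cond_edge_exp n (ergm k H n \<theta> (\<lambda>_. \<beta>0)) e G) =
      score (ergm_energy k H n \<theta> (\<lambda>_. \<beta>0)) (incident_pairs n i) G" for i
    unfolding score_def
  proof (rule sum.cong[OF refl])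
    fix e assume "e \<in> incident_pairs n i"
    then have e: "e \<in> pairs n" by (simp add: incident_pairs_def)
    then have "edge_var G e = of_bool (e \<in> G)"
      using G by (auto simp: edge_var_def adj_def graphs_def pairs_def)
    then show "edge_var G e - cond_edge_exp n (ergm k H n \<theta> (\<lambda>_. \<beta>0)) e G =
        of_bool (e \<in> G) - logistic (marginal (ergm_energy k H n \<theta> (\<lambda>_. \<beta>0)) e G)"
      by (simp add: cond_edge_exp_ergm[OF G e])
  qed
  then show ?thesis
    unfolding max_test_def using n by (simp add: Max_gr_iff)
qed

section \<open>Tail bound and drift of the vertex statistics\<close>

lemma card_incident_pairs:
  assumes "i \<in> {1..n}"
  shows "card (incident_pairs n i) = n - 1"
proof -
  have "bij_betw (\<lambda>j. (min i j, max i j)) ({1..n} - {i}) (incident_pairs n i)"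
    unfolding bij_betw_def
  proof
    show "inj_on (\<lambda>j. (min i j, max i j)) ({1..n} - {i})"
      by (auto simp: inj_on_def min_def max_def split: if_splits)
    show "(\<lambda>j. (min i j, max i j)) ` ({1..n} - {i}) = incident_pairs n i"
    proof (safe, goal_cases)
      case (1 a b j)
      then show ?case using assms
        by (auto simp: incident_pairs_def pairs_def min_def max_def split: if_splits)
    next
      case (2 a b)
      then show ?case using assms
        by (intro image_eqI[of _ _ "if i = a then b else a"])
           (auto simp: incident_pairs_def pairs_def min_def max_def split: if_splits)
    qed
  qed
  then show ?thesis using assms by (simp flip: bij_betw_same_card)
qed

lemma prob_ergm:
  "measure_pmf.prob (ergm k H n \<theta> \<beta>) {G. P G} =
    (\<Sum>G | G \<subseteq> pairs n \<and> P G. exp (ergm_energy k H n \<theta> \<beta> G)) /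
    (\<Sum>G\<in>Pow (pairs n). exp (ergm_energy k H n \<theta> \<beta> G))"
proof -
  let ?p = "ergm k H n \<theta> \<beta>"
  have "{G. P G} \<inter> set_pmf ?p = {G. G \<subseteq> pairs n \<and> P G}"
    by (auto simp: set_pmf_ergm graphs_def)
  then have "measure_pmf.prob ?p {G. P G} = measure_pmf.prob ?p {G. G \<subseteq> pairs n \<and> P G}"
    by (metis measure_Int_set_pmf)
  also have "\<dots> = (\<Sum>G | G \<subseteq> pairs n \<and> P G. pmf ?p G)"
    by (intro measure_measure_pmf_finite) (simp add: finite_pairs)
  also have "\<dots> = (\<Sum>G | G \<subseteq> pairs n \<and> P G.
      exp (ergm_energy k H n \<theta> \<beta> G) / (\<Sum>G\<in>Pow (pairs n). exp (ergm_energy k H n \<theta> \<beta> G)))"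
    by (intro sum.cong refl) (simp add: pmf_ergm graphs_def ergm_Z_def ergm_weight_eq)
  finally show ?thesis by (simp only: sum_divide_distrib)
qed

text \<open>The degree part of the marginal does not depend on \<open>G\<close> and cancels, which
  makes the bound uniform in \<open>\<beta>\<close>.\<close>

lemma marginal_energy_remove:
  assumes G: "G \<in> graphs n" and H: "H \<in> graphs k"
    and e: "e \<in> incident_pairs n i" "e' \<in> incident_pairs n i" "e' \<noteq> e"
    and k: "k \<ge> 2" and \<theta>: "\<theta> \<ge> 0" and n: "n \<ge> 1"
  shows "\<bar>marginal (ergm_energy k H n \<theta> \<beta>) e' G - marginal (ergm_energy k H n \<theta> \<beta>) e' (G - {e})\<bar>
    \<le> \<theta> * real k ^ 3 / real n"
proof -
  have G': "G - {e} \<in> graphs n" and e': "e' \<in> pairs n"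
    using G e by (auto simp: graphs_def incident_pairs_def)
  let ?d = "\<bar>marginal (subgraph_count k H n) e' G - marginal (subgraph_count k H n) e' (G - {e})\<bar>"
  have "?d / real n ^ (k - 2) \<le> real k ^ 3 / real n"
    using marginal_subgraph_count_remove[OF G H e k] n by (simp add: field_simps)
  then have "\<theta> * (?d / real n ^ (k - 2)) \<le> \<theta> * (real k ^ 3 / real n)"
    using \<theta> by (rule mult_left_mono)
  moreover have "\<bar>marginal (ergm_energy k H n \<theta> \<beta>) e' G - marginal (ergm_energy k H n \<theta> \<beta>) e' (G - {e})\<bar>
      = \<bar>\<theta> / real n ^ (k - 2) *
          (marginal (subgraph_count k H n) e' G - marginal (subgraph_count k H n) e' (G - {e}))\<bar>"
    by (simp add: marginal_energy[OF G e'] marginal_energy[OF G' e'] right_diff_distrib)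
  ultimately show ?thesis
    using \<theta> by (simp add: abs_mult)
qed

text \<open>The quadratic term of the Chernoff exponent is at most
  \<open>K * exp K / 2 * ln n\<close> and the linear term equals
  \<open>(K * exp K / 2 + 2) * ln n\<close>. The surplus \<open>2 * ln n\<close> leaves room for a
  union bound over \<open>n\<close> vertices.\<close>

lemma ergm_score_tail:
  fixes k n :: nat and \<theta> \<sigma> :: real
  assumes H: "H \<in> graphs k" and k: "k \<ge> 2" and \<theta>: "\<theta> \<ge> 0"
    and i: "i \<in> {1..n}" and \<sigma>: "\<bar>\<sigma>\<bar> = 1"
  defines "K \<equiv> 1 + \<theta> * real k ^ 3"
  shows "measure_pmf.prob (ergm k H n \<theta> \<beta>)
      {G. (K * exp K / 2 + 2) * sqrt (real n * ln (real n)) \<le>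
          \<sigma> * score (ergm_energy k H n \<theta> \<beta>) (incident_pairs n i) G}
    \<le> 1 / (real n)\<^sup>2"
proof -
  let ?W = "ergm_energy k H n \<theta> \<beta>" and ?S = "incident_pairs n i"
  define c where "c = (K * exp K / 2 + 2) * sqrt (real n * ln (real n))"
  \<comment> \<open>The right order for a variance proxy of order \<open>n\<close>; it is at most 1
    since \<open>ln n \<le> n\<close>.\<close>
  define t where "t = sqrt (ln (real n) / real n)"
  let ?x = "real (card ?S) * (K * exp K) * t\<^sup>2 / 2 - t * c"
  have n: "n \<ge> 1" using i by auto
  have ln0: "ln (real n) \<ge> 0" using n by simp
  have t: "0 \<le> t" "t \<le> 1"
    using n ln0 ln_bound[of "real n"] by (auto simp: t_def)
  have tsq: "t\<^sup>2 = ln (real n) / real n" using n ln0 by (simp add: t_def)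
  have tc: "t * c = (K * exp K / 2 + 2) * ln (real n)"
  proof -
    have "t * sqrt (real n * ln (real n)) = sqrt (ln (real n) / real n * (real n * ln (real n)))"
      by (simp only: t_def real_sqrt_mult)
    also have "ln (real n) / real n * (real n * ln (real n)) = (ln (real n))\<^sup>2"
      using n by (simp add: power2_eq_square)
    finally show ?thesis using ln0 by (simp add: c_def)
  qed
  have card: "real (card ?S) \<le> real n" using card_incident_pairs[OF i] by simp
  have K: "K \<ge> 1" using \<theta> by (simp add: K_def)
  have tail: "(\<Sum>G | G \<subseteq> pairs n \<and> c \<le> \<sigma> * score ?W ?S G. exp (?W G))
      \<le> (\<Sum>G\<in>Pow (pairs n). exp (?W G)) * exp ?x"
    unfolding K_def
  proof (rule score_tail[OF finite_pairs _ _ _ _ \<sigma> t])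
    show "?S \<subseteq> pairs n" by (auto simp: incident_pairs_def)
    show "\<bar>marginal ?W e' G - marginal ?W e' (G - {e})\<bar> \<le> \<theta> * real k ^ 3 / real n"
      if "G \<subseteq> pairs n" "e \<in> ?S" "e' \<in> ?S" "e' \<noteq> e" for G e e'
      using that by (intro marginal_energy_remove[OF _ H _ _ _ k \<theta> n]) (auto simp: graphs_def)
    show "0 \<le> \<theta> * real k ^ 3 / real n" using \<theta> by simp
    then have "real (card ?S) * (\<theta> * real k ^ 3 / real n) \<le> real n * (\<theta> * real k ^ 3 / real n)"
      using card by (rule mult_right_mono[rotated])
    then show "real (card ?S) * (\<theta> * real k ^ 3 / real n) \<le> \<theta> * real k ^ 3" using n by simp
  qed
  have "(\<Sum>G\<in>Pow (pairs n). exp (?W G)) > 0"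
    by (intro sum_pos) (auto simp: finite_pairs)
  with tail have "measure_pmf.prob (ergm k H n \<theta> \<beta>) {G. c \<le> \<sigma> * score ?W ?S G} \<le> exp ?x"
    unfolding prob_ergm by (simp add: pos_divide_le_eq mult.commute)
  also have "?x \<le> - (2 * ln (real n))"
  proof -
    have "real (card ?S) * ((K * exp K) * t\<^sup>2 / 2) \<le> real n * ((K * exp K) * t\<^sup>2 / 2)"
      using card K by (intro mult_right_mono) auto
    also have "\<dots> = K * exp K / 2 * ln (real n)" using n by (simp add: tsq)
    finally show ?thesis unfolding tc by (simp add: algebra_simps)
  qed
  then have "exp ?x \<le> exp (- (2 * ln (real n)))" by simp
  also have "\<dots> = 1 / (real n)\<^sup>2"
    using n by (simp add: exp_minus exp_double inverse_eq_divide)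
  finally show ?thesis unfolding c_def .
qed

text \<open>The subgraph parts of the true and null log odds coincide, while the parameters at an
  edge containing \<open>i\<close> add at least \<open>a\<close>. As the null log odds stay in
  \<open>[2 * \<beta>0, 2 * \<beta>0 + \<theta> * k ^ 2]\<close>, each of the \<open>n - 1\<close>
  edges gains a uniform multiple of \<open>a\<close>.\<close>

lemma score_drift:
  fixes k n :: nat and \<theta> \<beta>0 a :: real
  assumes G: "G \<in> graphs n" and H: "H \<in> graphs k" and k: "k \<ge> 2" and \<theta>: "\<theta> \<ge> 0"
    and i: "i \<in> {1..n}" and a: "0 \<le> a" "a \<le> 1"
    and \<beta>i: "\<beta>0 + a \<le> \<beta> i" and \<beta>: "\<And>j. j \<in> {1..n} \<Longrightarrow> \<beta>0 \<le> \<beta> j"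
  shows "score (ergm_energy k H n \<theta> \<beta>) (incident_pairs n i) G +
      real (n - 1) * (logistic (2 * \<beta>0) * logistic (- (2 * \<beta>0 + \<theta> * real k ^ 2)) * (a / 2))
    \<le> score (ergm_energy k H n \<theta> (\<lambda>_. \<beta>0)) (incident_pairs n i) G"
proof -
  let ?S = "incident_pairs n i"
  let ?W = "ergm_energy k H n \<theta> \<beta>" and ?N = "ergm_energy k H n \<theta> (\<lambda>_. \<beta>0)"
  let ?d = "logistic (2 * \<beta>0) * logistic (- (2 * \<beta>0 + \<theta> * real k ^ 2)) * (a / 2)"
  have n: "n \<ge> 1" using i by auto
  have "score ?W ?S G + real (n - 1) * ?d = (\<Sum>e\<in>?S. of_bool (e \<in> G) - logistic (marginal ?W e G) + ?d)"
    using card_incident_pairs[OF i] by (simp add: score_def sum.distrib)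
  also have "\<dots> \<le> score ?N ?S G"
    unfolding score_def
  proof (rule sum_mono)
    fix e assume e: "e \<in> ?S"
    then have ep: "e \<in> pairs n" and ei: "i = fst e \<or> i = snd e" by (auto simp: incident_pairs_def)
    let ?m = "\<theta> / real n ^ (k - 2) * marginal (subgraph_count k H n) e G"
    note bounds = marginal_subgraph_count_bounds[OF G H ep k]
    have m0: "0 \<le> ?m" using bounds(1) \<theta> by simp
    have "marginal (subgraph_count k H n) e G / real n ^ (k - 2) \<le> real k ^ 2"
      using bounds(2) n by (simp add: pos_divide_le_eq)
    from mult_left_mono[OF this \<theta>] have m1: "?m \<le> \<theta> * real k ^ 2" by simp
    have "fst e \<in> {1..n}" "snd e \<in> {1..n}" using ep by (auto simp: pairs_def)
    then have "2 * \<beta>0 + a \<le> \<beta> (fst e) + \<beta> (snd e)"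
      using ei \<beta>i \<beta>[of "fst e"] \<beta>[of "snd e"] by auto
    then have "marginal ?N e G + a \<le> marginal ?W e G"
      by (simp add: marginal_energy[OF G ep])
    moreover have "2 * \<beta>0 \<le> marginal ?N e G" "marginal ?N e G \<le> 2 * \<beta>0 + \<theta> * real k ^ 2"
      using m0 m1 by (simp_all add: marginal_energy[OF G ep])
    ultimately have "?d \<le> logistic (marginal ?W e G) - logistic (marginal ?N e G)"
      using a by (intro logistic_increment)
    then show "of_bool (e \<in> G) - logistic (marginal ?W e G) + ?d
        \<le> of_bool (e \<in> G) - logistic (marginal ?N e G)" by linarith
  qed
  finally show ?thesis .
qed

section \<open>The two error probabilities and the limit\<close>

text \<open>Union bound over the vertices, using the upper tail only.\<close>

lemma max_test_type_I:
  fixes k n :: nat and \<theta> \<beta>0 :: real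
  assumes H: "H \<in> graphs k" and k: "k \<ge> 2" and \<theta>: "\<theta> \<ge> 0" and n: "n \<ge> 1"
  defines "K \<equiv> 1 + \<theta> * real k ^ 3"
  defines "L \<equiv> (K * exp K / 2 + 2) * sqrt (real n * ln (real n))"
  shows "measure_pmf.prob (ergm k H n \<theta> (\<lambda>_. \<beta>0)) {G. max_test k H n \<theta> \<beta>0 L G = 1} \<le> 1 / real n"
proof -
  let ?p = "ergm k H n \<theta> (\<lambda>_. \<beta>0)"
  let ?B = "\<lambda>i. {G. L \<le> 1 * score (ergm_energy k H n \<theta> (\<lambda>_. \<beta>0)) (incident_pairs n i) G}"
  \<comment> \<open>Restricting to the support makes the description of the test by scores
    available.\<close>
  have "measure_pmf.prob ?p {G. max_test k H n \<theta> \<beta>0 L G = 1} =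
      measure_pmf.prob ?p ({G. max_test k H n \<theta> \<beta>0 L G = 1} \<inter> graphs n)"
    using measure_Int_set_pmf[of ?p "{G. max_test k H n \<theta> \<beta>0 L G = 1}"] by (simp add: set_pmf_ergm)
  also have "\<dots> \<le> measure_pmf.prob ?p (\<Union>i\<in>{1..n}. ?B i)"
  proof (intro measure_pmf.finite_measure_mono subsetI)
    fix G assume "G \<in> {G. max_test k H n \<theta> \<beta>0 L G = 1} \<inter> graphs n"
    then obtain i where "i \<in> {1..n}"
      and "L < score (ergm_energy k H n \<theta> (\<lambda>_. \<beta>0)) (incident_pairs n i) G"
      using max_test_eq_1_iff[OF _ n] by blast
    then show "G \<in> (\<Union>i\<in>{1..n}. ?B i)"
      by (intro UN_I[of i]) simp_all
  qed simp
  also have "\<dots> \<le> (\<Sum>i\<in>{1..n}. measure_pmf.prob ?p (?B i))"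
    by (intro measure_pmf.finite_measure_subadditive_finite) auto
  also have "\<dots> \<le> (\<Sum>i\<in>{1..n}. 1 / (real n)\<^sup>2)"
    unfolding L_def K_def by (intro sum_mono ergm_score_tail[OF H k \<theta>]) auto
  also have "\<dots> = 1 / real n" using n by (simp add: power2_eq_square)
  finally show ?thesis .
qed

text \<open>One vertex of the support suffices. Acceptance forces its null score to be at most
  \<open>L\<close>; the drift is at least \<open>2 * L\<close>, so the true score is at most
  \<open>- L\<close>, a lower tail event whose bound is free of \<open>\<beta>\<close>.\<close>

lemma max_test_type_II:
  fixes k n :: nat and \<theta> \<beta>0 A \<kappa> :: real
  assumes H: "H \<in> graphs k" and k: "k \<ge> 2" and \<theta>: "\<theta> \<ge> 0" and n: "n \<ge> 2"
  defines "K \<equiv> 1 + \<theta> * real k ^ 3"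
  defines "C \<equiv> K * exp K / 2 + 2"
  defines "\<kappa> \<equiv> 8 * C / (logistic (2 * \<beta>0) * logistic (- (2 * \<beta>0 + \<theta> * real k ^ 2)))"
  defines "L \<equiv> C * sqrt (real n * ln (real n))"
  assumes small: "\<kappa> * sqrt (ln (real n) / real n) \<le> 1"
    and A: "\<kappa> * sqrt (ln (real n) / real n) \<le> A"
    and s: "s \<ge> 1" and \<beta>: "\<beta> \<in> alternative n \<beta>0 s A"
  shows "measure_pmf.prob (ergm k H n \<theta> \<beta>) {G. max_test k H n \<theta> \<beta>0 L G = 0} \<le> 1 / (real n)\<^sup>2"
proof -
  let ?p = "ergm k H n \<theta> \<beta>"
  define c where "c = logistic (2 * \<beta>0) * logistic (- (2 * \<beta>0 + \<theta> * real k ^ 2))"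
  \<comment> \<open>The threshold replaces \<open>A\<close>, which may exceed 1, because the drift
    estimate needs a shift of at most 1.\<close>
  define a where "a = \<kappa> * sqrt (ln (real n) / real n)"
  have c: "c > 0" by (simp add: c_def logistic_pos)
  have C: "C > 0" using \<theta> by (simp add: C_def K_def add_nonneg_pos)
  have \<kappa>: "\<kappa> = 8 * C / c" by (simp add: \<kappa>_def c_def)
  have ln0: "ln (real n) \<ge> 0" using n by simp
  have a: "0 \<le> a" "a \<le> 1" "a \<le> A"
    using small A c C ln0 by (auto simp: a_def \<kappa>)
  from \<beta> obtain \<mu> where \<mu>: "\<beta> = (\<lambda>i. \<beta>0 + \<mu> i)" "card (supp n \<mu>) \<ge> s" "\<And>i. i \<in> supp n \<mu> \<Longrightarrow> A \<le> \<mu> i"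
    by (auto simp: alternative_def)
  have "supp n \<mu> \<noteq> {}" using \<mu>(2) s by auto
  then obtain i where i: "i \<in> supp n \<mu>" by blast
  then have iin: "i \<in> {1..n}" by (simp add: supp_def)
  have \<beta>i: "\<beta>0 + a \<le> \<beta> i" using \<mu>(1) \<mu>(3)[OF i] a by simp
  have \<beta>j: "\<beta>0 \<le> \<beta> j" if "j \<in> {1..n}" for j
    using \<mu>(1) \<mu>(3)[of j] a that by (cases "\<mu> j = 0") (auto simp: supp_def)
  \<comment> \<open>The factor 8 in \<open>\<kappa>\<close> pays for
    \<open>n - 1 \<ge> n / 2\<close>, for the \<open>a / 2\<close> in the drift, and for reaching
    \<open>2 * L\<close> instead of \<open>L\<close>.\<close>
  have drift: "2 * L \<le> real (n - 1) * (c * (a / 2))"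
  proof -
    have "real n * sqrt (ln (real n) / real n) = sqrt (real n * ln (real n))"
      using n by (simp add: real_sqrt_divide real_sqrt_mult real_div_sqrt field_simps)
    then have "real n / 2 * (c * (a / 2)) = 2 * L"
      unfolding a_def L_def \<kappa> using c by (simp add: field_simps)
    moreover have "real n / 2 * (c * (a / 2)) \<le> real (n - 1) * (c * (a / 2))"
      using n c a by (intro mult_right_mono) auto
    ultimately show ?thesis by linarith
  qed
  have n1: "n \<ge> 1" using n by simp
  have "measure_pmf.prob ?p {G. max_test k H n \<theta> \<beta>0 L G = 0} =
      measure_pmf.prob ?p ({G. max_test k H n \<theta> \<beta>0 L G = 0} \<inter> graphs n)"
    using measure_Int_set_pmf[of ?p "{G. max_test k H n \<theta> \<beta>0 L G = 0}"] by (simp add: set_pmf_ergm)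
  also have "\<dots> \<le> measure_pmf.prob ?p
      {G. L \<le> (- 1) * score (ergm_energy k H n \<theta> \<beta>) (incident_pairs n i) G}"
  proof (intro measure_pmf.finite_measure_mono subsetI)
    fix G assume "G \<in> {G. max_test k H n \<theta> \<beta>0 L G = 0} \<inter> graphs n"
    then have G: "G \<in> graphs n" and "max_test k H n \<theta> \<beta>0 L G \<noteq> 1" by auto
    then have "score (ergm_energy k H n \<theta> (\<lambda>_. \<beta>0)) (incident_pairs n i) G \<le> L"
      unfolding max_test_eq_1_iff[OF G n1] using iin not_less by blast
    with drift score_drift[of G n H k \<theta> i a \<beta>0 \<beta>, OF G H k \<theta> iin a(1,2) \<beta>i \<beta>j]
    show "G \<in> {G. L \<le> (- 1) * score (ergm_energy k H n \<theta> \<beta>) (incident_pairs n i) G}"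
      unfolding c_def by simp
  qed simp
  also have "\<dots> \<le> 1 / (real n)\<^sup>2"
    unfolding L_def C_def K_def by (rule ergm_score_tail[OF H k \<theta> iin]) simp
  finally show ?thesis .
qed

text \<open>A real supremum can be estimated through its members only over a nonempty set. The shift
  \<open>max A 1\<close> is nonzero even if \<open>A = 0\<close>, so its support is all of
  \<open>{1..n}\<close>.\<close>

lemma alternative_nonempty:
  assumes "s \<le> n"
  shows "alternative n \<beta>0 s A \<noteq> {}"
proof -
  have "supp n (\<lambda>_. max A 1) = {1..n}" by (auto simp: supp_def)
  then have "(\<lambda>i. \<beta>0 + max A 1) \<in> alternative n \<beta>0 s A"
    unfolding alternative_def using assms by (intro CollectI exI[of _ "\<lambda>_. max A 1"]) auto
  then show ?thesis by blast
qed

theorem theorem1p4: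
  fixes \<zeta> :: nat and H :: graph and \<theta> \<beta>0 :: real
  assumes "\<zeta> \<ge> 2" and "connected_graph \<zeta> H" and "\<theta> > 0"
  shows "\<exists>\<kappa>>0. \<exists>C>0. \<forall>(s :: nat \<Rightarrow> nat) (A :: nat \<Rightarrow> real).
           (\<forall>n\<ge>1. s n \<in> {1..n} \<and> A n \<ge> \<kappa> * sqrt (ln (real n) / real n)) \<longrightarrow>
           (let T = (\<lambda>n. max_test \<zeta> H n \<theta> \<beta>0 (C * sqrt (real n * ln (real n)))) in
             (\<lambda>n. measure_pmf.prob (ergm \<zeta> H n \<theta> (\<lambda>_. \<beta>0)) {G. T n G = 1} +
                  (SUP \<beta>\<in>alternative n \<beta>0 (s n) (A n).
                     measure_pmf.prob (ergm \<zeta> H n \<theta> \<beta>) {G. T n G = 0}))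
             \<longlonglongrightarrow> 0)"
proof -
  \<comment> \<open>The constants depend on \<open>\<zeta>\<close>, \<open>\<theta>\<close> and
    \<open>\<beta>0\<close> only and are fixed before \<open>s\<close> and \<open>A\<close>.\<close>
  define K where "K = 1 + \<theta> * real \<zeta> ^ 3"
  define C where "C = K * exp K / 2 + 2"
  define \<kappa> where "\<kappa> = 8 * C / (logistic (2 * \<beta>0) * logistic (- (2 * \<beta>0 + \<theta> * real \<zeta> ^ 2)))"
  have C: "C > 0" using assms(3) by (simp add: C_def K_def add_nonneg_pos)
  have \<kappa>: "\<kappa> > 0" using C by (simp add: \<kappa>_def logistic_pos)
  have H: "H \<in> graphs \<zeta>" using assms(2) by (simp add: connected_graph_def)
  have \<theta>: "\<theta> \<ge> 0" using assms(3) by simp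
  define T where "T = (\<lambda>n. max_test \<zeta> H n \<theta> \<beta>0 (C * sqrt (real n * ln (real n))))"
  have "(\<lambda>n. measure_pmf.prob (ergm \<zeta> H n \<theta> (\<lambda>_. \<beta>0)) {G. T n G = 1} +
          (SUP \<beta>\<in>alternative n \<beta>0 (s n) (A n). measure_pmf.prob (ergm \<zeta> H n \<theta> \<beta>) {G. T n G = 0}))
        \<longlonglongrightarrow> 0"
    if sA: "\<forall>n\<ge>1. s n \<in> {1..n} \<and> A n \<ge> \<kappa> * sqrt (ln (real n) / real n)"
    for s :: "nat \<Rightarrow> nat" and A :: "nat \<Rightarrow> real"
  proof -
    let ?I = "\<lambda>n. measure_pmf.prob (ergm \<zeta> H n \<theta> (\<lambda>_. \<beta>0)) {G. T n G = 1}"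
    let ?II = "\<lambda>n. SUP \<beta>\<in>alternative n \<beta>0 (s n) (A n). measure_pmf.prob (ergm \<zeta> H n \<theta> \<beta>) {G. T n G = 0}"
    have "(\<lambda>n. \<kappa> * sqrt (ln (real n) / real n)) \<longlonglongrightarrow> \<kappa> * sqrt 0"
      by (intro tendsto_intros lim_ln_over_n)
    then have "eventually (\<lambda>n. \<kappa> * sqrt (ln (real n) / real n) < 1) sequentially"
      by (rule order_tendstoD) simp
    then have ev: "eventually (\<lambda>n. n \<ge> 2 \<and> \<kappa> * sqrt (ln (real n) / real n) \<le> 1) sequentially"
      using eventually_ge_at_top[of 2] by eventually_elim auto
    have nonempty: "alternative n \<beta>0 (s n) (A n) \<noteq> {}" if "n \<ge> 2" for n
      using sA that by (intro alternative_nonempty) auto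
    have bdd: "bdd_above ((\<lambda>\<beta>. measure_pmf.prob (ergm \<zeta> H n \<theta> \<beta>) {G. T n G = 0}) `
        alternative n \<beta>0 (s n) (A n))" for n
      by (rule bdd_aboveI2[of _ _ 1]) simp
    have upper: "?I n + ?II n \<le> 1 / real n + 1 / (real n)\<^sup>2"
      if "n \<ge> 2 \<and> \<kappa> * sqrt (ln (real n) / real n) \<le> 1" for n
    proof (rule add_mono)
      show "?I n \<le> 1 / real n"
        unfolding T_def C_def K_def using that
        by (intro max_test_type_I[OF H assms(1) \<theta>]) auto
      show "?II n \<le> 1 / (real n)\<^sup>2"
      proof (rule cSUP_least)
        fix \<beta> assume "\<beta> \<in> alternative n \<beta>0 (s n) (A n)"
        then show "measure_pmf.prob (ergm \<zeta> H n \<theta> \<beta>) {G. T n G = 0} \<le> 1 / (real n)\<^sup>2"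
          unfolding T_def C_def K_def using that sA
          by (intro max_test_type_II[where s = "s n" and A = "A n", OF H assms(1) \<theta>])
            (auto simp: \<kappa>_def C_def K_def)
      qed (use that nonempty in simp)
    qed
    \<comment> \<open>Nonnegativity of a real supremum is not automatic: it is inherited from one
      member of the alternative, using the upper bound 1.\<close>
    have lower: "0 \<le> ?I n + ?II n" if n: "n \<ge> 2" for n
    proof (rule add_nonneg_nonneg)
      obtain \<beta> where "\<beta> \<in> alternative n \<beta>0 (s n) (A n)" using nonempty[OF n] by blast
      then have "measure_pmf.prob (ergm \<zeta> H n \<theta> \<beta>) {G. T n G = 0} \<le> ?II n"
        using bdd by (rule cSUP_upper)
      then show "0 \<le> ?II n" by (rule order_trans[rotated]) simp
    qed simp
    have "(\<lambda>n. 1 / real n + (1 / real n) ^ 2) \<longlonglongrightarrow> 0 + 0 ^ 2"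
      by (intro tendsto_intros lim_1_over_n)
    then have lim: "(\<lambda>n. 1 / real n + 1 / (real n)\<^sup>2) \<longlonglongrightarrow> 0" by (simp add: power_divide)
    show ?thesis
    proof (rule tendsto_sandwich[OF _ _ tendsto_const lim])
      show "eventually (\<lambda>n. 0 \<le> ?I n + ?II n) sequentially"
        using ev by eventually_elim (use lower in blast)
      show "eventually (\<lambda>n. ?I n + ?II n \<le> 1 / real n + 1 / (real n)\<^sup>2) sequentially"
        using ev by eventually_elim (use upper in blast)
    qed
  qed
  then show ?thesis
    using C \<kappa> unfolding T_def Let_def by blast
qed

end
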